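(* Let $\mathcal{P}$ be a family of probability measures on $\Omega=C([0,\infty);\mathbb{R}^k)$ with upper capacity $c$, and let $X=(X_t)_{t\in[0,\infty)}$ be a process. If $X$ is a quasi-continuous process on $\Omega\times[0,T]$ (resp. on $\Omega\times[0,\infty)$) and $\tau:\Omega\to[0,T]$ (resp. $\tau:\Omega\to[0,\infty)$) is a quasi-continuous stopping time, then the random variable $X_\tau$ is quasi-continuous.
   Context: $\Omega=C([0,\infty);\mathbb{R}^k)$ with the (metrizable) topology of locally uniform convergence; $B_t(\omega)=\omega_t$, $\mathcal{F}_t=\sigma\{B_s:s\le t\}$; a stopping time $\tau$ satisfies $\{\tau\le t\}\in\mathcal{F}_t$ for each $t\ge0$. $c(A)=\sup_{P\in\mathcal{P}}P(A)$. A function $\xi:\Omega\to\mathbb{R}$ is quasi-continuous if for each $\varepsilon>0$ there is an open $O\subset\Omega$ with $c(O)<\varepsilon$ such that $\xi|_{O^c}$ is continuous. A process $F$ is quasi-continuous on $\Omega\times[0,T]$ (resp. $\Omega\times[0,\infty)$) if for each $\varepsilon>0$ there is an open $G\subset\Omega$ with $c(G)<\varepsilon$ such that $(\omega,t)\mapsto F_t(\omega)$ is continuous on $G^c\times[0,T]$ (resp. $G^c\times[0,\infty)$). *)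

theory Defs
  imports "HOL-Probability.Probability"
begin

section \<open>The path space \<open>C([0,\<infinity>); \<real>\<^sup>k)\<close>\<close>

text \<open>A path is a function continuous on \<open>[0,\<infinity>)\<close>; its values at negative times are fixed to
  \<^const>\<open>undefined\<close>, so that two paths are equal iff they agree on \<open>[0,\<infinity>)\<close>.\<close>

typedef (overloaded) 'k cpath =
  "{\<omega> :: real \<Rightarrow> real ^ ('k::finite). continuous_on {0..} \<omega> \<and> \<omega> \<in> extensional {0..}}"
  morphisms path_fun Abs_cpath
proof (intro exI CollectI conjI)
  show "continuous_on {0..} (restrict (\<lambda>_. 0 :: real ^ 'k) {0..})"
    by (rule continuous_on_eq[OF continuous_on_const[of _ 0]]) simp
qed simp

definition canonical :: "real \<Rightarrow> ('k::finite) cpath \<Rightarrow> real ^ 'k" where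
  "canonical t \<omega> = path_fun \<omega> t"

text \<open>Topology of locally uniform convergence: the uniform tubes
  \<open>{\<omega>'. \<forall>t\<in>[0,N]. dist (\<omega>' t) (\<omega> t) < \<epsilon>}\<close> form a neighbourhood base at \<open>\<omega>\<close>.\<close>

instantiation cpath :: (finite) topological_space
begin

definition open_cpath :: "'a cpath set \<Rightarrow> bool" where
  "open_cpath U \<longleftrightarrow>
     (\<forall>\<omega>\<in>U. \<exists>N\<ge>0. \<exists>\<epsilon>>0. \<forall>\<omega>'.
        (\<forall>t\<in>{0..N}. dist (canonical t \<omega>') (canonical t \<omega>) < \<epsilon>) \<longrightarrow> \<omega>' \<in> U)"

instance
proof
  show "open (UNIV :: 'a cpath set)"
    unfolding open_cpath_def by (auto intro: exI[of _ 0] exI[of _ 1])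
next
  fix S T :: "'a cpath set"
  assume S: "open S" and T: "open T"
  show "open (S \<inter> T)"
    unfolding open_cpath_def
  proof
    fix \<omega> assume w: "\<omega> \<in> S \<inter> T"
    obtain N e where 1: "N \<ge> 0" "e > 0"
      "\<And>\<omega>'. (\<forall>t\<in>{0..N}. dist (canonical t \<omega>') (canonical t \<omega>) < e) \<Longrightarrow> \<omega>' \<in> S"
      using S w unfolding open_cpath_def by blast
    obtain M d where 2: "M \<ge> 0" "d > 0"
      "\<And>\<omega>'. (\<forall>t\<in>{0..M}. dist (canonical t \<omega>') (canonical t \<omega>) < d) \<Longrightarrow> \<omega>' \<in> T"
      using T w unfolding open_cpath_def by blast
    show "\<exists>N\<ge>0. \<exists>\<epsilon>>0. \<forall>\<omega>'.
        (\<forall>t\<in>{0..N}. dist (canonical t \<omega>') (canonical t \<omega>) < \<epsilon>) \<longrightarrow> \<omega>' \<in> S \<inter> T"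
    proof (intro exI conjI allI impI)
      show "0 \<le> max N M" "0 < min e d" using 1 2 by auto
      fix \<omega>'
      assume *: "\<forall>t\<in>{0..max N M}. dist (canonical t \<omega>') (canonical t \<omega>) < min e d"
      have "\<omega>' \<in> S" by (rule 1(3)) (use * in auto)
      moreover have "\<omega>' \<in> T" by (rule 2(3)) (use * in auto)
      ultimately show "\<omega>' \<in> S \<inter> T" by simp
    qed
  qed
next
  fix K :: "'a cpath set set"
  assume K: "\<forall>S\<in>K. open S"
  show "open (\<Union>K)"
    unfolding open_cpath_def
  proof
    fix \<omega> assume "\<omega> \<in> \<Union>K"
    then obtain S where S: "S \<in> K" "\<omega> \<in> S" by blast
    then obtain N e where "N \<ge> 0" "e > 0"
      "\<And>\<omega>'. (\<forall>t\<in>{0..N}. dist (canonical t \<omega>') (canonical t \<omega>) < e) \<Longrightarrow> \<omega>' \<in> S"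
      using K unfolding open_cpath_def by blast
    with S show "\<exists>N\<ge>0. \<exists>\<epsilon>>0. \<forall>\<omega>'.
        (\<forall>t\<in>{0..N}. dist (canonical t \<omega>') (canonical t \<omega>) < \<epsilon>) \<longrightarrow> \<omega>' \<in> \<Union>K"
      by blast
  qed
qed

end

lemma tendsto_cpath_iff:
  fixes f :: "'b \<Rightarrow> ('k::finite) cpath"
  shows "(f \<longlongrightarrow> \<omega>) F \<longleftrightarrow>
    (\<forall>N\<ge>0. uniform_limit {0..N} (\<lambda>n t. canonical t (f n)) (\<lambda>t. canonical t \<omega>) F)"
proof
  assume lim: "(f \<longlongrightarrow> \<omega>) F"
  show "\<forall>N\<ge>0. uniform_limit {0..N} (\<lambda>n t. canonical t (f n)) (\<lambda>t. canonical t \<omega>) F"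
  proof (intro allI impI, rule uniform_limitI)
    fix N e :: real
    assume N: "N \<ge> 0" and e: "e > 0"
    define V where "V = {\<omega>'. \<exists>r<e. \<forall>t\<in>{0..N}. dist (canonical t \<omega>') (canonical t \<omega>) \<le> r}"
    have "open V"
      unfolding open_cpath_def
    proof
      fix \<omega>1 assume "\<omega>1 \<in> V"
      then obtain r where r: "r < e" "\<And>t. t \<in> {0..N} \<Longrightarrow> dist (canonical t \<omega>1) (canonical t \<omega>) \<le> r"
        unfolding V_def by blast
      have "\<omega>2 \<in> V"
        if near: "\<forall>t\<in>{0..N}. dist (canonical t \<omega>2) (canonical t \<omega>1) < (e - r) / 2" for \<omega>2
      proof -
        have "dist (canonical t \<omega>2) (canonical t \<omega>) \<le> (e + r) / 2" if t: "t \<in> {0..N}" for t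
        proof -
          have "dist (canonical t \<omega>2) (canonical t \<omega>)
              \<le> dist (canonical t \<omega>2) (canonical t \<omega>1) + dist (canonical t \<omega>1) (canonical t \<omega>)"
            by (rule dist_triangle)
          also have "\<dots> \<le> (e - r) / 2 + r"
            using near[rule_format, OF t] r(2)[OF t] by argo
          finally show ?thesis by (simp add: field_simps)
        qed
        moreover have "(e + r) / 2 < e" using r(1) by simp
        ultimately show ?thesis unfolding V_def by blast
      qed
      then show "\<exists>N\<ge>0. \<exists>\<epsilon>>0. \<forall>\<omega>'.
          (\<forall>t\<in>{0..N}. dist (canonical t \<omega>') (canonical t \<omega>1) < \<epsilon>) \<longrightarrow> \<omega>' \<in> V"
        using N r(1) by (intro exI[of _ N] exI[of _ "(e - r) / 2"] conjI) auto
    qed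
    moreover have "\<omega> \<in> V" using e unfolding V_def by (auto intro!: exI[of _ 0])
    ultimately have "eventually (\<lambda>n. f n \<in> V) F" using lim by (metis topological_tendstoD)
    then show "\<forall>\<^sub>F n in F. \<forall>t\<in>{0..N}. dist (canonical t (f n)) (canonical t \<omega>) < e"
      by eventually_elim (auto simp: V_def dest: le_less_trans)
  qed
next
  assume unif: "\<forall>N\<ge>0. uniform_limit {0..N} (\<lambda>n t. canonical t (f n)) (\<lambda>t. canonical t \<omega>) F"
  show "(f \<longlongrightarrow> \<omega>) F"
  proof (rule topological_tendstoI)
    fix S :: "'k cpath set" assume "open S" "\<omega> \<in> S"
    then obtain N e where *: "N \<ge> 0" "e > 0"
      "\<And>\<omega>'. (\<forall>t\<in>{0..N}. dist (canonical t \<omega>') (canonical t \<omega>) < e) \<Longrightarrow> \<omega>' \<in> S"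
      unfolding open_cpath_def by blast
    from unif * have "\<forall>\<^sub>F n in F. \<forall>t\<in>{0..N}. dist (canonical t (f n)) (canonical t \<omega>) < e"
      by (auto dest: uniform_limitD)
    then show "\<forall>\<^sub>F n in F. f n \<in> S" by eventually_elim (rule *)
  qed
qed

section \<open>Stopping times\<close>

text \<open>For \<open>t < 0\<close> this is the trivial \<open>\<sigma>\<close>-algebra, so for nonnegative \<open>\<tau>\<close> the condition in
  \<^const>\<open>stopping_time\<close>, which ranges over all real \<open>t\<close>, only says something for \<open>t \<ge> 0\<close>.\<close>

definition canonical_filtration :: "real \<Rightarrow> ('k::finite) cpath measure" where
  "canonical_filtration t =
     sigma UNIV {canonical s -` A | s A. s \<in> {0..t} \<and> A \<in> sets borel}"

lemma stopping_time_canonical_iff: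
  fixes \<tau> :: "('k::finite) cpath \<Rightarrow> real"
  assumes "\<And>\<omega>. 0 \<le> \<tau> \<omega>"
  shows "stopping_time canonical_filtration \<tau> \<longleftrightarrow>
    (\<forall>t\<ge>0. {\<omega>. \<tau> \<omega> \<le> t} \<in> sets (canonical_filtration t))"
proof -
  have sp: "space (canonical_filtration t :: 'k cpath measure) = UNIV" for t
    by (simp add: canonical_filtration_def space_measure_of_conv)
  have neg: "{\<omega>. \<tau> \<omega> \<le> t} = {}" if "t < 0" for t
    using assms that by (auto simp: not_le intro: less_le_trans)
  have "{\<omega>. \<tau> \<omega> \<le> t} \<in> sets (canonical_filtration t)" if "t < 0" for t
    by (simp add: neg[OF that])
  then show ?thesis
    unfolding stopping_time_def pred_def sp by (auto simp: not_le) (meson not_le)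
qed

section \<open>Capacity and quasi-continuity\<close>

text \<open>The values lie in \<^typ>\<open>ennreal\<close>, so the capacity of an empty family is \<open>0\<close>. It is only
  meaningful on measurable sets, and is only used on open ones.\<close>

definition upper_capacity :: "'a measure set \<Rightarrow> 'a set \<Rightarrow> ennreal" where
  "upper_capacity \<P> A = (SUP P\<in>\<P>. emeasure P A)"

definition quasi_continuous ::
  "('k::finite) cpath measure set \<Rightarrow> ('k cpath \<Rightarrow> real) \<Rightarrow> bool" where
  "quasi_continuous \<P> \<xi> \<longleftrightarrow>
     (\<forall>\<epsilon>>0. \<exists>U. open U \<and> upper_capacity \<P> U < ennreal \<epsilon> \<and> continuous_on (- U) \<xi>)"

definition quasi_continuous_process ::
  "('k::finite) cpath measure set \<Rightarrow> real set \<Rightarrow> (real \<Rightarrow> 'k cpath \<Rightarrow> real) \<Rightarrow> bool" where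
  "quasi_continuous_process \<P> I F \<longleftrightarrow>
     (\<forall>\<epsilon>>0. \<exists>G. open G \<and> upper_capacity \<P> G < ennreal \<epsilon> \<and>
        continuous_on ((- G) \<times> I) (\<lambda>(\<omega>, t). F t \<omega>))"

end

theory Submission
  imports Defs
begin

text \<open>Outside a small open set \<open>G\<close> the map (\<omega>, t) \<mapsto> X_t(\<omega>)
  is jointly continuous, and outside a small open set \<open>U\<close> so is \<tau>. Off G \<union>
  U, X_\<tau> is therefore the graph map \<omega> \<mapsto> (\<omega>, \<tau>(\<omega>)) followed by
  the joint map, a composition of continuous maps. Subadditivity of the capacity
  (\<open>upper_capacity_Un_le\<close>) keeps the exceptional set small: with \<epsilon>/2 for each
  of \<open>G\<close> and \<open>U\<close>, the union stays below \<epsilon>.\<close>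

lemma upper_capacity_Un_le:
  assumes "\<And>P. P \<in> \<P> \<Longrightarrow> A \<in> sets P" "\<And>P. P \<in> \<P> \<Longrightarrow> B \<in> sets P"
  shows "upper_capacity \<P> (A \<union> B) \<le> upper_capacity \<P> A + upper_capacity \<P> B"
  unfolding upper_capacity_def
proof (rule SUP_least)
  fix P assume P: "P \<in> \<P>"
  have "emeasure P (A \<union> B) \<le> emeasure P A + emeasure P B"
    using assms P by (intro emeasure_subadditive) auto
  \<comment> \<open>Each term is bounded by its own supremum; the two suprema may be approached
    along different measures, so only an inequality results.\<close>
  also have "\<dots> \<le> (SUP P\<in>\<P>. emeasure P A) + (SUP P\<in>\<P>. emeasure P B)"
    using P by (intro add_mono SUP_upper)
  finally show "emeasure P (A \<union> B) \<le> (SUP P\<in>\<P>. emeasure P A) + (SUP P\<in>\<P>. emeasure P B)" .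
qed

text \<open>The time set \<open>I\<close> is kept arbitrary so that one argument covers both the
  bounded horizon \<open>{0..T}\<close> and the half-line \<open>{0..}\<close>.\<close>

lemma quasi_continuous_process_at_random_time:
  fixes \<P> :: "('k::finite) cpath measure set"
  assumes \<P>: "\<And>P. P \<in> \<P> \<Longrightarrow> sets P = sets borel"
    and X: "quasi_continuous_process \<P> I X"
    and \<tau>: "quasi_continuous \<P> \<tau>" "range \<tau> \<subseteq> I"
  shows "quasi_continuous \<P> (\<lambda>\<omega>. X (\<tau> \<omega>) \<omega>)"
  unfolding quasi_continuous_def
proof (intro allI impI)
  fix \<epsilon> :: real assume "\<epsilon> > 0"
  then have half: "\<epsilon> / 2 > 0" by simp
  obtain G where G: "open G" "upper_capacity \<P> G < ennreal (\<epsilon> / 2)"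
      "continuous_on ((- G) \<times> I) (\<lambda>(\<omega>, t). X t \<omega>)"
    using X half unfolding quasi_continuous_process_def by blast
  obtain U where U: "open U" "upper_capacity \<P> U < ennreal (\<epsilon> / 2)" "continuous_on (- U) \<tau>"
    using \<tau>(1) half unfolding quasi_continuous_def by blast
  \<comment> \<open>Open sets are Borel, hence measurable for every P in the family.\<close>
  have "upper_capacity \<P> (G \<union> U) \<le> upper_capacity \<P> G + upper_capacity \<P> U"
    using \<P> G(1) U(1) by (intro upper_capacity_Un_le) auto
  also have "\<dots> < ennreal (\<epsilon> / 2) + ennreal (\<epsilon> / 2)"
    using G(2) U(2) by (rule add_strict_mono)
  also have "\<dots> = ennreal \<epsilon>"
    using half by (simp flip: ennreal_plus)
  finally have "upper_capacity \<P> (G \<union> U) < ennreal \<epsilon>" .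
  moreover have "continuous_on (- (G \<union> U)) (\<lambda>\<omega>. X (\<tau> \<omega>) \<omega>)"
  proof -
    have "continuous_on (- (G \<union> U)) (\<lambda>\<omega>. (\<omega>, \<tau> \<omega>))"
      by (intro continuous_on_Pair continuous_on_id continuous_on_subset[OF U(3)]) auto
    \<comment> \<open>Joint continuity of X is available only for times in \<open>I\<close>, so the
      graph of \<tau> must stay over \<open>I\<close>.\<close>
    moreover have "(\<lambda>\<omega>. (\<omega>, \<tau> \<omega>)) ` (- (G \<union> U)) \<subseteq> (- G) \<times> I"
      using \<tau>(2) by auto
    ultimately show ?thesis
      using continuous_on_compose2[OF G(3)] by fastforce
  qed
  ultimately show "\<exists>U. open U \<and> upper_capacity \<P> U < ennreal \<epsilon> \<and>
      continuous_on (- U) (\<lambda>\<omega>. X (\<tau> \<omega>) \<omega>)"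
    using G(1) U(1) by blast
qed

theorem proposition4p4:
  fixes \<P> :: "('k::finite) cpath measure set"
    and X :: "real \<Rightarrow> 'k cpath \<Rightarrow> real"
    and \<tau> :: "'k cpath \<Rightarrow> real"
    and T :: real
  assumes "\<And>P. P \<in> \<P> \<Longrightarrow> prob_space P \<and> sets P = sets borel"
  shows "(quasi_continuous_process \<P> {0..T} X
          \<and> range \<tau> \<subseteq> {0..T} \<and> stopping_time canonical_filtration \<tau> \<and> quasi_continuous \<P> \<tau>
          \<longrightarrow> quasi_continuous \<P> (\<lambda>\<omega>. X (\<tau> \<omega>) \<omega>))
    \<and> (quasi_continuous_process \<P> {0..} X
          \<and> range \<tau> \<subseteq> {0..} \<and> stopping_time canonical_filtration \<tau> \<and> quasi_continuous \<P> \<tau>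
          \<longrightarrow> quasi_continuous \<P> (\<lambda>\<omega>. X (\<tau> \<omega>) \<omega>))"
  using assms by (blast intro: quasi_continuous_process_at_random_time)

end
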